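(* Let $\Sigma,\Sigma_2$ be symmetric positive definite $d\times d$ matrices, $\mu\in\mathbb{R}^d$, and consider the model in which observations $x_1,\dots,x_n\in\mathbb{R}^d$ ($n\ge1$) are a sample from $\mathcal{N}(\theta,\Sigma)$ with unknown mean $\theta\in\mathbb{R}^d$. Let $P_1$ denote the posterior distribution of $\theta$ given $(x_1,\dots,x_n)$ under the uniform prior, and $P_2$ the posterior distribution of $\theta$ given $(x_1,\dots,x_n)$ under the prior $\mathcal{N}(\mu,\Sigma_2)$. Then, with $\bar x=\frac1n\sum_{i=1}^nx_i$, $$d_{\mathcal{W}}(P_1,P_2)\le|\!|\!|\Sigma|\!|\!|\;|\!|\!|(\Sigma+n\Sigma_2)^{-1}|\!|\!|\;\|\bar x-\mu\|+\frac{\sqrt2\,\Gamma(d/2+1/2)}{\Gamma(d/2)}\,\frac{|\!|\!|\Sigma|\!|\!|}{n}\,|\!|\!|(\Sigma_2+n\Sigma_2\Sigma^{-1}\Sigma_2)^{-1/2}|\!|\!|.$$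
   Context: $\|\cdot\|$ is the Euclidean norm and $|\!|\!|A|\!|\!|=\sup_{\|x\|=1}\|Ax\|$ is the operator norm. $\Gamma$ is the Gamma function. The likelihood is $\prod_{i=1}^n(2\pi)^{-d/2}\det(\Sigma)^{-1/2}\exp\left(-\tfrac12(x_i-\theta)^T\Sigma^{-1}(x_i-\theta)\right)$. The uniform prior is the (improper) Lebesgue measure on $\mathbb{R}^d$, so $P_1$ has density in $\theta$ proportional to the likelihood, and $P_2$ has density in $\theta$ proportional to the likelihood times the $\mathcal{N}(\mu,\Sigma_2)$ density. The 1-Wasserstein distance is $d_{\mathcal{W}}(P_1,P_2)=\sup_h\left|\int h\,dP_1-\int h\,dP_2\right|$ over all $h:\mathbb{R}^d\to\mathbb{R}$ with Lipschitz constant at most $1$. *)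

theory Defs
  imports "HOL-Analysis.Analysis"
begin

definition sym_pos_def :: "real^'d^'d \<Rightarrow> bool" where
  "sym_pos_def A \<longleftrightarrow> transpose A = A \<and> (\<forall>v. v \<noteq> 0 \<longrightarrow> 0 < v \<bullet> (A *v v))"

(* The principal square root: every symmetric positive definite A has exactly one
   symmetric positive definite root.  Nothing is claimed for other arguments. *)
definition pd_sqrt :: "real^'d^'d \<Rightarrow> real^'d^'d" where
  "pd_sqrt A = (THE B. sym_pos_def B \<and> B ** B = A)"

definition opnorm :: "real^'d^'d \<Rightarrow> real" where
  "opnorm A = onorm (\<lambda>v. A *v v)"

definition mvn_density :: "real^'d \<Rightarrow> real^'d^'d \<Rightarrow> real^'d \<Rightarrow> real" where
  "mvn_density \<theta> \<Sigma> x =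
     (2 * pi) powr (- real CARD('d) / 2) * det \<Sigma> powr (- 1 / 2)
       * exp (- 1 / 2 * ((x - \<theta>) \<bullet> (matrix_inv \<Sigma> *v (x - \<theta>))))"

definition mvn :: "real^'d \<Rightarrow> real^'d^'d \<Rightarrow> (real^'d) measure" where
  "mvn \<theta> \<Sigma> = density lborel (\<lambda>x. ennreal (mvn_density \<theta> \<Sigma> x))"

definition likelihood :: "real^'d^'d \<Rightarrow> nat \<Rightarrow> (nat \<Rightarrow> real^'d) \<Rightarrow> real^'d \<Rightarrow> real" where
  "likelihood \<Sigma> n x \<theta> = (\<Prod>i=1..n. mvn_density \<theta> \<Sigma> (x i))"

(* The prior need not be finite: the uniform prior is lborel itself.
   Meaningful when the normalising constant is positive and finite. *)
definition posterior :: "'a measure \<Rightarrow> ('a \<Rightarrow> real) \<Rightarrow> 'a measure" where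
  "posterior prior L =
     density prior (\<lambda>\<theta>. ennreal (L \<theta>) / (\<integral>\<^sup>+ t. ennreal (L t) \<partial>prior))"

(* Extended-real valued, so that an unbounded supremum is infinity rather than arbitrary.
   Meaningful for measures with finite first moment, where every Lipschitz h is integrable
   (the Bochner integral of a non-integrable function is 0). *)
definition wasserstein1 :: "'a::metric_space measure \<Rightarrow> 'a measure \<Rightarrow> ereal" where
  "wasserstein1 P Q =
     (SUP h\<in>{h :: 'a \<Rightarrow> real. 1-lipschitz_on UNIV h}.
        ereal \<bar>(\<integral>x. h x \<partial>P) - (\<integral>x. h x \<partial>Q)\<bar>)"

end

theory Submission
  imports Defs
begin

text \<open>The posteriors are \<open>P\<^sub>1 = N(xbar, A)\<close> with \<open>A = \<Sigma> / n\<close> and \<open>P\<^sub>2 = N(m, (A\<^sup>-\<^sup>1 + \<Sigma>\<^sub>2\<^sup>-\<^sup>1)\<^sup>-\<^sup>1)\<close> with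
  \<open>xbar - m = \<Sigma> (\<Sigma> + n \<Sigma>\<^sub>2)\<^sup>-\<^sup>1 (xbar - \<mu>)\<close>. For factors \<open>U\<close>, \<open>T\<close> of the covariances both are images of one
  standard Gaussian vector \<open>Z\<close>, so the distance is at most \<open>\<bar>xbar - m\<bar> + onorm (U - T) * E \<bar>Z\<bar>\<close>. Put
  \<open>R = (\<Sigma>\<^sub>2 + n \<Sigma>\<^sub>2 \<Sigma>\<^sup>-\<^sup>1 \<Sigma>\<^sub>2)\<^sup>-\<^sup>1\<^sup>/\<^sup>2\<close> and \<open>T = \<Sigma>\<^sub>2 R\<close>; a suitable \<open>U\<close> has \<open>onorm (U - T) \<le> onorm A * onorm R\<close>.\<close>

subsection \<open>Square roots of positive definite matrices\<close>

text \<open>A maximiser \<open>v\<close> of the Rayleigh quotient on the unit sphere of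
  \<open>V\<close> is an eigenvector: if the residual \<open>g = f v - c v\<close> were nonzero, a
  short step from \<open>v\<close> along \<open>g\<close> would raise the quotient above its maximum
  \<open>c\<close>.\<close>

lemma self_adjoint_eigenvector:
  fixes f :: "'a::euclidean_space \<Rightarrow> 'a"
  assumes lin: "linear f" and sub: "subspace V" and inv: "\<And>x. x \<in> V \<Longrightarrow> f x \<in> V"
    and sym: "\<And>x y. f x \<bullet> y = x \<bullet> f y" and ne: "V \<noteq> {0}"
  obtains v c where "v \<in> V" "norm v = 1" "f v = c *\<^sub>R v"
proof -
  interpret linear f by fact
  have "compact (sphere 0 1 \<inter> V)"
    using sub by (simp add: closed_subspace compact_Int_closed)
  moreover obtain w where w: "w \<in> V" "w \<noteq> 0"
    using ne sub subspace_0 by fastforce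
  have "sgn w \<in> sphere 0 1 \<inter> V"
    using w sub by (simp add: norm_sgn sgn_div_norm subspace_scale)
  then have "sphere 0 1 \<inter> V \<noteq> {}" by blast
  moreover have "continuous_on (sphere 0 1 \<inter> V) (\<lambda>x. x \<bullet> f x)"
    using lin by (intro continuous_intros linear_continuous_on linear_conv_bounded_linear[THEN iffD1])
  ultimately obtain v where "v \<in> sphere 0 1 \<inter> V"
    and "\<forall>x\<in>sphere 0 1 \<inter> V. x \<bullet> f x \<le> v \<bullet> f v"
    using continuous_attains_sup[of "sphere 0 1 \<inter> V" "\<lambda>x. x \<bullet> f x"] by blast
  then have v: "v \<in> V" "norm v = 1"
    and max: "\<And>x. x \<in> V \<Longrightarrow> norm x = 1 \<Longrightarrow> x \<bullet> f x \<le> v \<bullet> f v"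
    by auto
  define c where "c = v \<bullet> f v"
  \<comment> \<open>Both sides are quadratic in \<open>x\<close>, so the maximum over unit vectors
    controls all of \<open>V\<close>.\<close>
  have le: "x \<bullet> f x \<le> c * (x \<bullet> x)" if "x \<in> V" for x
  proof (cases "x = 0")
    case False
    have "sgn x \<bullet> f (sgn x) \<le> c"
      unfolding c_def using False that sub
      by (intro max) (simp_all add: norm_sgn sgn_div_norm subspace_scale)
    then have "(x \<bullet> f x) / (norm x)\<^sup>2 \<le> c"
      by (simp add: sgn_div_norm scale power2_eq_square field_simps)
    then show ?thesis
      using False by (simp add: divide_simps power2_norm_eq_inner split: if_splits)
  qed simp
  define g where "g = f v - c *\<^sub>R v"
  have gV: "g \<in> V" unfolding g_def using v inv sub by (simp add: subspace_diff subspace_scale)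
  have "g = 0"
  proof (rule ccontr)
    assume "g \<noteq> 0"
    define K where "K = c * (g \<bullet> g) - g \<bullet> f g"
    have K: "K \<ge> 0" using le[OF gV] by (simp add: K_def)
    define G where "G = g \<bullet> g"
    have G: "G > 0" using \<open>g \<noteq> 0\<close> by (simp add: G_def)
    \<comment> \<open>To first order the step gains \<open>2 * t * G\<close>, to second order it
      loses \<open>t^2 * K\<close>. This \<open>t\<close> keeps \<open>t * K\<close> at most
      \<open>G\<close>, so the gain wins; the \<open>+ 1\<close> guards against
      \<open>K = 0\<close>.\<close>
    define t where "t = G / (K + 1)"
    have t: "t > 0" using G K by (simp add: t_def)
    have vv: "v \<bullet> v = 1" using v by (simp add: norm_eq_1)
    have "(v + t *\<^sub>R g) \<bullet> f (v + t *\<^sub>R g) \<le> c * ((v + t *\<^sub>R g) \<bullet> (v + t *\<^sub>R g))"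
      using v gV sub by (intro le) (simp add: subspace_add subspace_scale)
    also have "(v + t *\<^sub>R g) \<bullet> (v + t *\<^sub>R g) = 1 + 2 * t * (g \<bullet> v) + t\<^sup>2 * (g \<bullet> g)"
      using vv by (simp add: algebra_simps power2_eq_square inner_commute)
    also have "(v + t *\<^sub>R g) \<bullet> f (v + t *\<^sub>R g) = c + 2 * t * (g \<bullet> f v) + t\<^sup>2 * (g \<bullet> f g)"
      using sym[of v g] by (simp add: add scale algebra_simps c_def power2_eq_square inner_commute)
    finally have "2 * t * (g \<bullet> f v - c * (g \<bullet> v)) \<le> t\<^sup>2 * K"
      by (simp add: K_def algebra_simps)
    moreover have "G = g \<bullet> f v - c * (g \<bullet> v)"
      unfolding G_def by (subst (2) g_def) (simp add: inner_diff_right)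
    ultimately have "t * (2 * G) \<le> t * (t * K)"
      by (simp add: power2_eq_square mult_ac)
    then have "2 * G \<le> t * K" using t by (simp only: mult_le_cancel_left_pos)
    also have "\<dots> \<le> G" using K G by (simp add: t_def field_simps)
    finally show False using G by simp
  qed
  then have "f v = c *\<^sub>R v" by (simp add: g_def)
  then show thesis using that v by blast
qed

text \<open>Spectral theorem by induction on the dimension: an eigenvector is split off, and its
  orthogonal complement inside \<open>V\<close> is again invariant because \<open>f\<close> is
  self-adjoint. Allowing any invariant subspace is what lets the induction pass to this
  complement.\<close>

lemma self_adjoint_orthonormal_eigenbasis:
  fixes f :: "'a::euclidean_space \<Rightarrow> 'a"
  assumes lin: "linear f" and sym: "\<And>x y. f x \<bullet> y = x \<bullet> f y"
    and "subspace V" and "\<And>x. x \<in> V \<Longrightarrow> f x \<in> V"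
  shows "\<exists>B c. finite B \<and> B \<subseteq> V \<and> pairwise orthogonal B
    \<and> (\<forall>b\<in>B. norm b = 1 \<and> f b = c b *\<^sub>R b) \<and> (\<forall>x\<in>V. x = (\<Sum>b\<in>B. (x \<bullet> b) *\<^sub>R b))"
  using assms(3,4)
proof (induction "dim V" arbitrary: V rule: less_induct)
  case less
  show ?case
  proof (cases "V = {0}")
    case True
    then show ?thesis by (intro exI[of _ "{}"]) auto
  next
    case False
    obtain v d where v: "v \<in> V" "norm v = 1" "f v = d *\<^sub>R v"
      using self_adjoint_eigenvector[OF lin less.prems sym False] by metis
    define W where "W = {x \<in> V. x \<bullet> v = 0}"
    have vv: "v \<bullet> v = 1" using v by (simp add: norm_eq_1)
    have W: "subspace W"
      using less.prems(1) by (auto simp: W_def subspace_def inner_add_left)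
    have inv: "f x \<in> W" if "x \<in> W" for x
      using that less.prems(2) v(3) sym[of x v] by (simp add: W_def)
    have "v \<notin> W" using vv by (simp add: W_def)
    then have "W \<subset> V" using v(1) unfolding W_def by blast
    then have "span W \<subset> span V"
      using W less.prems(1) by (simp add: span_eq_iff[THEN iffD2])
    then have "dim W < dim V" by (rule dim_psubset)
    from less.hyps[OF this W inv] obtain B c where
      B: "finite B" "B \<subseteq> W" "pairwise orthogonal B" "\<forall>b\<in>B. norm b = 1 \<and> f b = c b *\<^sub>R b"
        "\<forall>x\<in>W. x = (\<Sum>b\<in>B. (x \<bullet> b) *\<^sub>R b)" by blast
    have vB: "b \<bullet> v = 0" if "b \<in> B" for b using B(2) that by (auto simp: W_def)
    then have nB: "v \<notin> B" using vv by force
    show ?thesis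
    proof (intro exI[of _ "insert v B"] exI[of _ "c(v := d)"] conjI ballI)
      show "finite (insert v B)" "insert v B \<subseteq> V" using B v by (auto simp: W_def)
      show "pairwise orthogonal (insert v B)"
        using B(3) vB by (auto simp: pairwise_insert orthogonal_def inner_commute)
      show "norm b = 1" "f b = (c(v := d)) b *\<^sub>R b" if "b \<in> insert v B" for b
        using that v B(4) nB by auto
      fix x assume x: "x \<in> V"
      have "x - (x \<bullet> v) *\<^sub>R v \<in> W"
        using x v less.prems(1) vv
        by (simp add: W_def subspace_diff subspace_scale inner_diff_left)
      then have "x - (x \<bullet> v) *\<^sub>R v = (\<Sum>b\<in>B. ((x - (x \<bullet> v) *\<^sub>R v) \<bullet> b) *\<^sub>R b)"
        using B(5) by blast
      also have "\<dots> = (\<Sum>b\<in>B. (x \<bullet> b) *\<^sub>R b)"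
        using vB by (intro sum.cong) (auto simp: inner_diff_left inner_commute[of v])
      finally show "x = (\<Sum>b\<in>insert v B. (x \<bullet> b) *\<^sub>R b)"
        using B(1) nB by (simp add: algebra_simps)
    qed
  qed
qed

lemma inner_symmetric_matrix:
  fixes A :: "real^'n^'n"
  assumes "transpose A = A"
  shows "(A *v x) \<bullet> y = x \<bullet> (A *v y)"
  using assms by (metis dot_lmul_matrix transpose_matrix_vector)

lemma symmetric_matrixI:
  fixes A :: "real^'n^'n"
  assumes "\<And>x y. (A *v x) \<bullet> y = x \<bullet> (A *v y)"
  shows "transpose A = A"
  using adjoint_unique[of "(*v) A" "(*v) A"] adjoint_matrix[of A] assms
  by (metis matrix_of_matrix_vector_mul)

text \<open>\<open>D\<close> kills every member of the orthonormal eigenbasis. The intended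
  \<open>D\<close> is the difference of two square roots.\<close>

lemma symmetric_matrix_eq_0:
  fixes D :: "real^'n^'n"
  assumes sym: "transpose D = D" and eig: "\<And>v c. v \<noteq> 0 \<Longrightarrow> D *v v = c *\<^sub>R v \<Longrightarrow> c = 0"
  shows "D = 0"
proof -
  have "\<exists>B c. finite B \<and> B \<subseteq> UNIV \<and> pairwise orthogonal B \<and> (\<forall>b\<in>B. norm b = 1 \<and> D *v b = c b *\<^sub>R b)
     \<and> (\<forall>x\<in>UNIV. x = (\<Sum>b\<in>B. (x \<bullet> b) *\<^sub>R b))"
    by (rule self_adjoint_orthonormal_eigenbasis) (auto simp: inner_symmetric_matrix[OF sym])
  then obtain B c where B: "\<And>b. b \<in> B \<Longrightarrow> norm b = 1 \<and> D *v b = c b *\<^sub>R b"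
    "\<And>x. x = (\<Sum>b\<in>B. (x \<bullet> b) *\<^sub>R b)" by auto
  have "D *v x = 0" for x
  proof -
    have D0: "D *v b = 0" if "b \<in> B" for b
      using B(1)[OF that] eig[of b "c b"] by (cases "b = 0") auto
    have "D *v x = (\<Sum>b\<in>B. (x \<bullet> b) *\<^sub>R (D *v b))"
      by (subst B(2)[of x]) (simp add: linear_sum[OF matrix_vector_mul_linear] matrix_vector_mult_scaleR)
    then show ?thesis using D0 by simp
  qed
  then show ?thesis by (metis matrix_eq matrix_vector_mult_0)
qed

text \<open>If \<open>B\<^sup>2 = C\<^sup>2\<close> then \<open>D = B - C\<close> satisfies \<open>B D + D C = 0\<close>, and testing this against an
  eigenvector of \<open>D\<close> shows that its eigenvalue vanishes.\<close>

lemma sym_pos_def_root_unique: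
  fixes B C :: "real^'n^'n"
  assumes B: "sym_pos_def B" and C: "sym_pos_def C" and eq: "B ** B = C ** C"
  shows "B = C"
proof -
  have sym: "transpose (B - C) = B - C"
    using B C by (simp add: sym_pos_def_def transpose_def vec_eq_iff)
  have "B - C = 0"
  proof (rule symmetric_matrix_eq_0[OF sym])
    fix v c assume v: "v \<noteq> 0" "(B - C) *v v = c *\<^sub>R v"
    have "B *v (B *v v) = C *v (C *v v)" using eq by (simp add: matrix_vector_mul_assoc)
    then have "v \<bullet> (B *v ((B - C) *v v)) + v \<bullet> ((B - C) *v (C *v v)) = 0"
      by (simp add: algebra_simps)
    also have "v \<bullet> ((B - C) *v (C *v v)) = ((B - C) *v v) \<bullet> (C *v v)"
      using inner_symmetric_matrix[OF sym] by simp
    finally have "c * (v \<bullet> (B *v v) + v \<bullet> (C *v v)) = 0"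
      using v by (simp add: algebra_simps)
    moreover have "v \<bullet> (B *v v) + v \<bullet> (C *v v) > 0"
      using B C v by (simp add: sym_pos_def_def add_pos_pos)
    ultimately show "c = 0" by simp
  qed
  then show ?thesis by simp
qed

text \<open>The root keeps the eigenvectors of \<open>A\<close> and replaces each eigenvalue by its
  square root.\<close>

lemma sym_pos_def_root_exists:
  fixes A :: "real^'n^'n"
  assumes A: "sym_pos_def A"
  shows "\<exists>S. sym_pos_def S \<and> S ** S = A"
proof -
  have symA: "(A *v x) \<bullet> y = x \<bullet> (A *v y)" for x y
    using A by (simp add: sym_pos_def_def inner_symmetric_matrix)
  have "\<exists>B c. finite B \<and> B \<subseteq> UNIV \<and> pairwise orthogonal B \<and> (\<forall>b\<in>B. norm b = 1 \<and> A *v b = c b *\<^sub>R b)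
     \<and> (\<forall>x\<in>UNIV. x = (\<Sum>b\<in>B. (x \<bullet> b) *\<^sub>R b))"
    by (rule self_adjoint_orthonormal_eigenbasis) (auto simp: symA)
  then obtain B c where fin: "finite B" and orth: "pairwise orthogonal B"
    and eig: "\<And>b. b \<in> B \<Longrightarrow> norm b = 1 \<and> A *v b = c b *\<^sub>R b"
    and expand: "\<And>x. x = (\<Sum>b\<in>B. (x \<bullet> b) *\<^sub>R b)" by auto
  have pos: "c b > 0" if "b \<in> B" for b
  proof -
    have "b \<noteq> 0" using eig[OF that] by auto
    then have "0 < b \<bullet> (A *v b)" using A unfolding sym_pos_def_def by blast
    moreover have "b \<bullet> b = 1" using eig[OF that] by (simp add: norm_eq_1)
    ultimately show ?thesis using eig[OF that] by simp
  qed
  define g where "g x = (\<Sum>b\<in>B. (sqrt (c b) * (x \<bullet> b)) *\<^sub>R b)" for x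
  have ling: "linear g"
    by (rule linearI)
      (simp_all add: g_def inner_add_left algebra_simps sum.distrib scaleR_sum_right)
  define S where "S = matrix g"
  have S: "S *v x = g x" for x unfolding S_def by (simp add: matrix_works ling)
  have "transpose S = S"
    by (rule symmetric_matrixI)
      (simp add: S g_def inner_sum_left inner_sum_right mult_ac inner_commute)
  moreover have "0 < v \<bullet> (S *v v)" if "v \<noteq> 0" for v
  proof -
    have "\<exists>b\<in>B. v \<bullet> b \<noteq> 0"
    proof (rule ccontr)
      assume "\<not> ?thesis"
      then have "(\<Sum>b\<in>B. (v \<bullet> b) *\<^sub>R b) = 0" by simp
      then show False using expand[of v] that by simp
    qed
    then obtain b where b: "b \<in> B" "v \<bullet> b \<noteq> 0" by blast
    have "v \<bullet> (S *v v) = (\<Sum>b\<in>B. sqrt (c b) * (v \<bullet> b)\<^sup>2)"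
      by (simp add: S g_def inner_sum_right power2_eq_square mult_ac)
    also have "\<dots> > 0"
      using b pos by (intro sum_pos2[OF fin, of b]) (auto simp: less_imp_le)
    finally show ?thesis .
  qed
  moreover have "S *v (S *v x) = A *v x" for x
  proof -
    have gb: "g b = sqrt (c b) *\<^sub>R b" if "b \<in> B" for b
    proof -
      have "g b = (\<Sum>b'\<in>B. if b' = b then sqrt (c b) *\<^sub>R b else 0)"
        unfolding g_def
      proof (rule sum.cong)
        fix b' assume "b' \<in> B"
        then show "(sqrt (c b') * (b \<bullet> b')) *\<^sub>R b' = (if b' = b then sqrt (c b) *\<^sub>R b else 0)"
          using orth that eig[OF that]
          by (auto simp: pairwise_def orthogonal_def norm_eq_1)
      qed simp
      then show ?thesis using fin that by simp
    qed
    have "g (g x) = (\<Sum>b\<in>B. (sqrt (c b) * (x \<bullet> b)) *\<^sub>R g b)"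
      by (subst (2) g_def) (simp add: linear_sum[OF ling] linear_scale[OF ling])
    also have "\<dots> = (\<Sum>b\<in>B. (x \<bullet> b) *\<^sub>R (A *v b))"
      using pos eig by (intro sum.cong) (auto simp: gb less_imp_le mult_ac)
    also have "\<dots> = A *v (\<Sum>b\<in>B. (x \<bullet> b) *\<^sub>R b)"
      by (simp add: linear_sum[OF matrix_vector_mul_linear] matrix_vector_mult_scaleR)
    finally show ?thesis using expand[of x] by (simp add: S)
  qed
  then have "S ** S = A" by (simp add: matrix_eq matrix_vector_mul_assoc)
  ultimately show ?thesis by (auto simp: sym_pos_def_def)
qed

text \<open>Existence and uniqueness justify the definite description in \<open>pd_sqrt\<close>; the
  rest of the proof uses the root only through these two facts.\<close>

lemma pd_sqrt:
  assumes "sym_pos_def A"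
  shows "sym_pos_def (pd_sqrt A)" and "pd_sqrt A ** pd_sqrt A = A"
proof -
  have "\<exists>!B. sym_pos_def B \<and> B ** B = A"
    using sym_pos_def_root_exists[OF assms] sym_pos_def_root_unique by metis
  from theI'[OF this] show "sym_pos_def (pd_sqrt A)" "pd_sqrt A ** pd_sqrt A = A"
    by (simp_all add: pd_sqrt_def)
qed

subsection \<open>Coupling of covariance factors\<close>

lemma sym_pos_defD:
  assumes "sym_pos_def A"
  shows "(A *v x) \<bullet> y = x \<bullet> (A *v y)" and "x \<noteq> 0 \<Longrightarrow> 0 < x \<bullet> (A *v x)"
  using assms by (simp_all add: sym_pos_def_def inner_symmetric_matrix)

lemma sym_pos_def_invertible:
  assumes "sym_pos_def A"
  shows "invertible A"
proof -
  have "x = 0" if "A *v x = 0" for x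
    using sym_pos_defD(2)[OF assms, of x] that by fastforce
  then show ?thesis
    by (simp add: invertible_left_inverse matrix_left_invertible_ker)
qed

lemma matrix_inv_vector:
  fixes A :: "real^'n^'n"
  assumes "invertible A"
  shows "A *v (matrix_inv A *v x) = x" and "matrix_inv A *v (A *v x) = x"
proof -
  have "A ** matrix_inv A = mat 1 \<and> matrix_inv A ** A = mat 1"
    using assms unfolding invertible_def matrix_inv_def by (rule someI_ex)
  then show "A *v (matrix_inv A *v x) = x" "matrix_inv A *v (A *v x) = x"
    by (simp_all add: matrix_vector_mul_assoc)
qed

lemma sym_pos_def_matrix_inv:
  assumes A: "sym_pos_def A"
  shows "sym_pos_def (matrix_inv A)"
proof -
  note inv = matrix_inv_vector[OF sym_pos_def_invertible[OF A]]
  have "(matrix_inv A *v x) \<bullet> y = x \<bullet> (matrix_inv A *v y)" for x y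
    using sym_pos_defD(1)[OF A, of "matrix_inv A *v x" "matrix_inv A *v y"] by (simp add: inv)
  moreover have "0 < x \<bullet> (matrix_inv A *v x)" if "x \<noteq> 0" for x
  proof -
    have "matrix_inv A *v x \<noteq> 0" using inv(1)[of x] that by force
    from sym_pos_defD(2)[OF A this] show ?thesis by (simp add: inv inner_commute)
  qed
  ultimately show ?thesis by (simp add: sym_pos_def_def symmetric_matrixI)
qed

lemma sym_pos_def_add:
  assumes "sym_pos_def A" "sym_pos_def B"
  shows "sym_pos_def (A + B)"
  using sym_pos_defD[OF assms(1)] sym_pos_defD[OF assms(2)]
  by (auto simp: sym_pos_def_def algebra_simps intro!: symmetric_matrixI add_pos_pos)

lemma sym_pos_def_scaleR:
  assumes "sym_pos_def A" "0 < c"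
  shows "sym_pos_def (c *\<^sub>R A)"
  using sym_pos_defD[OF assms(1)] assms(2)
  by (auto simp: sym_pos_def_def scaleR_matrix_vector_assoc[symmetric] intro!: symmetric_matrixI)

lemma sym_pos_def_mat_1: "sym_pos_def (mat 1)"
  by (simp add: sym_pos_def_def)

text \<open>Provides the positive definite matrices whose roots are taken in the coupling:
  \<open>P A^-1 P\<close>, to which \<open>P\<close> is added, and
  \<open>T^-1 A T^-T\<close>.\<close>

lemma sym_pos_def_congruence:
  fixes A B :: "real^'n^'n"
  assumes A: "sym_pos_def A" and B: "invertible B"
  shows "sym_pos_def (transpose B ** A ** B)"
proof -
  have tr: "x \<bullet> ((transpose B ** A ** B) *v y) = (B *v x) \<bullet> (A *v (B *v y))" for x y
    by (metis dot_lmul_matrix matrix_vector_mul_assoc transpose_matrix_vector inner_commute)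
  have "((transpose B ** A ** B) *v x) \<bullet> y = x \<bullet> ((transpose B ** A ** B) *v y)" for x y
    using tr[of x y] tr[of y x] sym_pos_defD(1)[OF A] by (simp add: inner_commute)
  moreover have "0 < x \<bullet> ((transpose B ** A ** B) *v x)" if "x \<noteq> 0" for x
  proof -
    have "B *v x \<noteq> 0" using matrix_inv_vector(2)[OF B, of x] that by force
    then show ?thesis using tr sym_pos_defD(2)[OF A] by simp
  qed
  ultimately show ?thesis by (simp add: sym_pos_def_def symmetric_matrixI)
qed

lemma bij_matrix_vector:
  fixes A :: "real^'n^'n"
  assumes "invertible A"
  shows "bij ((*v) A)"
  using assms by (simp add: invertible_eq_bij)

lemma opnorm_mult_le: "norm (A *v x) \<le> opnorm A * norm x"
  unfolding opnorm_def by (rule onorm) simp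

lemma opnorm_nonneg: "0 \<le> opnorm A"
  unfolding opnorm_def by (rule onorm_pos_le) simp

text \<open>\<open>T T\<^sup>T = (A\<^sup>-\<^sup>1 + P\<^sup>-\<^sup>1)\<^sup>-\<^sup>1\<close> and \<open>U U\<^sup>T = A\<close>, with \<open>U = T S\<close> for the positive definite root \<open>S\<close> of
  \<open>T\<^sup>-\<^sup>1 A T\<^sup>-\<^sup>T\<close>. This choice of \<open>S\<close> gives \<open>(U - T) (S + 1) = T (S\<^sup>2 - 1) = A R\<close>, and \<open>S + 1\<close> expands.\<close>

lemma gaussian_factor_coupling:
  fixes A P :: "real^'n^'n"
  assumes A: "sym_pos_def A" and P: "sym_pos_def P"
  defines "R \<equiv> matrix_inv (pd_sqrt (P + P ** matrix_inv A ** P))"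
  obtains T U :: "real^'n^'n" where "invertible T" "invertible U"
    "\<And>z. (T *v z) \<bullet> (matrix_inv A *v (T *v z)) + (T *v z) \<bullet> (matrix_inv P *v (T *v z)) = (norm z)\<^sup>2"
    "\<And>z. (U *v z) \<bullet> (matrix_inv A *v (U *v z)) = (norm z)\<^sup>2"
    "onorm (\<lambda>z. U *v z - T *v z) \<le> opnorm A * opnorm R"
proof -
  define A' P' where "A' = matrix_inv A" and "P' = matrix_inv P"
  define M where "M = P + P ** A' ** P"
  define Q where "Q = pd_sqrt M"
  have invA: "invertible A" and invP: "invertible P"
    using A P by (simp_all add: sym_pos_def_invertible)
  have A': "sym_pos_def A'" and P': "sym_pos_def P'"
    using A P by (simp_all add: A'_def P'_def sym_pos_def_matrix_inv)
  have "transpose P = P" using P by (simp add: sym_pos_def_def)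
  then have M: "sym_pos_def M"
    unfolding M_def using sym_pos_def_add[OF P] sym_pos_def_congruence[OF A' invP] by simp
  have Q: "sym_pos_def Q" and QQ: "Q ** Q = M" using pd_sqrt[OF M] by (simp_all add: Q_def)
  have R: "sym_pos_def R" and R_def: "R = matrix_inv Q"
    using sym_pos_def_matrix_inv[OF Q] by (simp_all add: R_def Q_def M_def A'_def)
  note invQ = sym_pos_def_invertible[OF Q] and invR = sym_pos_def_invertible[OF R]
  have AA: "A *v (A' *v x) = x" "A' *v (A *v x) = x" for x
    by (simp_all add: A'_def matrix_inv_vector invA)
  have PP: "P *v (P' *v x) = x" "P' *v (P *v x) = x" for x
    by (simp_all add: P'_def matrix_inv_vector invP)
  have QR: "Q *v (R *v x) = x" "R *v (Q *v x) = x" for x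
    by (simp_all add: R_def matrix_inv_vector invQ)
  have QQv: "Q *v (Q *v x) = P *v x + P *v (A' *v (P *v x))" for x
    by (simp add: matrix_vector_mul_assoc QQ M_def matrix_vector_mult_add_rdistrib matrix_mul_assoc)
  \<comment> \<open>\<open>M = P (A^-1 + P^-1) P\<close> and \<open>R\<close> is the inverse root of
    \<open>M\<close>, so \<open>T T^T = P M^-1 P\<close> is the inverse of
    \<open>A^-1 + P^-1\<close>.\<close>
  define T where "T = P ** R"
  have T: "T *v x = P *v (R *v x)" for x by (simp add: T_def matrix_vector_mul_assoc)
  \<comment> \<open>This is \<open>T^-1 A T^-T\<close>, since \<open>T^-1 = Q P'\<close>. Being a
    congruence of \<open>A\<close>, it has a positive definite root.\<close>
  define W where "W = Q ** P' ** A ** P' ** Q"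
  have Wv: "W *v x = Q *v (P' *v (A *v (P' *v (Q *v x))))" for x
    by (simp add: W_def matrix_vector_mul_assoc matrix_mul_assoc)
  have "transpose (P' ** Q) = Q ** P'"
    using P' Q by (simp add: sym_pos_def_def matrix_transpose_mul)
  then have W: "sym_pos_def W"
    using sym_pos_def_congruence[OF A, of "P' ** Q"] sym_pos_def_invertible[OF P'] invQ
    by (simp add: W_def matrix_mul_assoc invertible_mult)
  define S where "S = pd_sqrt W"
  have S: "sym_pos_def S" and SS: "S ** S = W" using pd_sqrt[OF W] by (simp_all add: S_def)
  have SSv: "S *v (S *v x) = W *v x" for x by (simp add: matrix_vector_mul_assoc SS)
  define U where "U = T ** S"
  have U: "U *v x = T *v (S *v x)" for x by (simp add: U_def matrix_vector_mul_assoc)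
  show thesis
  proof (rule that[of T U])
    show invT: "invertible T" unfolding T_def by (intro invertible_mult invP invR)
    show "invertible U"
      unfolding U_def by (intro invertible_mult invT sym_pos_def_invertible S)
    show "(T *v z) \<bullet> (matrix_inv A *v (T *v z)) + (T *v z) \<bullet> (matrix_inv P *v (T *v z)) = (norm z)\<^sup>2" for z
    proof -
      have "(T *v z) \<bullet> (A' *v (T *v z)) + (T *v z) \<bullet> (P' *v (T *v z))
          = (R *v z) \<bullet> (Q *v (Q *v (R *v z)))"
        by (simp add: T PP QQv sym_pos_defD(1)[OF P] inner_add_right)
      also have "\<dots> = (Q *v (R *v z)) \<bullet> (Q *v (R *v z))"
        by (rule sym_pos_defD(1)[OF Q, symmetric])
      also have "\<dots> = (norm z)\<^sup>2" by (simp add: QR power2_norm_eq_inner)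
      finally show ?thesis by (simp add: A'_def P'_def)
    qed
    show "(U *v z) \<bullet> (matrix_inv A *v (U *v z)) = (norm z)\<^sup>2" for z
    proof -
      \<comment> \<open>With \<open>z = S w\<close> the vector \<open>U z = T S S w = T W w\<close>
        collapses to \<open>A P' Q w\<close>, whose leading \<open>A\<close> cancels against
        \<open>A'\<close>.\<close>
      define w where "w = matrix_inv S *v z"
      have z: "z = S *v w" by (simp add: w_def matrix_inv_vector sym_pos_def_invertible S)
      have Uz: "U *v z = A *v (P' *v (Q *v w))"
        by (simp add: U T z SSv Wv QR PP)
      have "(U *v z) \<bullet> (A' *v (U *v z)) = (U *v z) \<bullet> (P' *v (Q *v w))"
        by (simp add: Uz AA)
      also have "\<dots> = (P *v (R *v (S *v z))) \<bullet> (P' *v (Q *v w))" by (simp add: U T)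
      also have "\<dots> = (S *v z) \<bullet> w"
        by (simp add: sym_pos_defD(1)[OF P] sym_pos_defD(1)[OF R] PP QR)
      also have "\<dots> = z \<bullet> z" by (simp add: sym_pos_defD(1)[OF S] z)
      finally show ?thesis by (simp add: A'_def power2_norm_eq_inner)
    qed
    \<comment> \<open>This is \<open>T (S^2 - 1) = A R\<close>: one has
      \<open>T W = A P' Q = A P' Q^2 R\<close>, and inserting \<open>Q^2 = P + P A' P\<close> leaves
      \<open>A R + P R\<close>.\<close>
    have TW: "T *v (W *v x) = T *v x + A *v (R *v x)" for x
    proof -
      have "T *v (W *v x) = A *v (P' *v (Q *v (Q *v (R *v x))))"
        by (simp add: T Wv QR PP)
      also have "\<dots> = A *v (R *v x) + P *v (R *v x)"
        by (simp only: QQv matrix_vector_right_distrib PP AA)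
      finally show ?thesis by (simp add: T)
    qed
    show "onorm (\<lambda>z. U *v z - T *v z) \<le> opnorm A * opnorm R"
    proof (rule onorm_le)
      fix z
      \<comment> \<open>Writing \<open>z = (S + 1) w\<close> turns \<open>U z - T z\<close> into
        \<open>T (S^2 - 1) w = A R w\<close>, so it remains to compare \<open>norm w\<close> with
        \<open>norm z\<close>.\<close>
      define w where "w = matrix_inv (S + mat 1) *v z"
      have "invertible (S + mat 1)"
        by (intro sym_pos_def_invertible sym_pos_def_add S sym_pos_def_mat_1)
      then have z: "z = S *v w + w"
        using matrix_inv_vector(1)[of "S + mat 1" z]
        by (simp add: w_def matrix_vector_mult_add_rdistrib)
      have "U *v z - T *v z = A *v (R *v w)"
        by (simp add: z U matrix_vector_right_distrib SSv TW)
      then have "norm (U *v z - T *v z) \<le> opnorm A * (opnorm R * norm w)"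
        using opnorm_mult_le[of A "R *v w"] opnorm_mult_le[of R w]
          mult_left_mono[OF _ opnorm_nonneg[of A]] by (metis order_trans)
      moreover have "norm w \<le> norm z"
      \<comment> \<open>The squared norm of \<open>S w + w\<close> exceeds that of \<open>w\<close>
        by the squared norm of \<open>S w\<close> plus twice the inner product of \<open>w\<close>
        and \<open>S w\<close>, both nonnegative.\<close>
      proof (rule power2_le_imp_le)
        have "0 \<le> w \<bullet> (S *v w)"
          using sym_pos_defD(2)[OF S, of w] by (cases "w = 0") auto
        then show "(norm w)\<^sup>2 \<le> (norm z)\<^sup>2"
          by (simp add: z power2_norm_eq_inner inner_add_left inner_add_right inner_commute)
      qed simp
      then have "opnorm A * (opnorm R * norm w) \<le> opnorm A * (opnorm R * norm z)"
        by (intro mult_left_mono opnorm_nonneg)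
      ultimately show "norm (U *v z - T *v z) \<le> opnorm A * opnorm R * norm z" by simp
    qed
  qed
qed

subsection \<open>Densities and likelihood\<close>

lemma mvn_density_pos:
  assumes "sym_pos_def \<Sigma>"
  shows "0 < mvn_density \<theta> \<Sigma> x"
  using sym_pos_def_invertible[OF assms] by (simp add: mvn_density_def invertible_det_nz)

lemma mvn_density_measurable [measurable]:
  "mvn_density \<theta> \<Sigma> \<in> borel_measurable borel" "(\<lambda>\<theta>. mvn_density \<theta> \<Sigma> x) \<in> borel_measurable borel"
  unfolding mvn_density_def
  by (intro borel_measurable_continuous_onI continuous_intros
      linear_continuous_on_compose[OF _ matrix_vector_mul_linear])+

lemma likelihood_measurable [measurable]: "likelihood \<Sigma> n x \<in> borel_measurable borel"
  unfolding likelihood_def by measurable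

lemma inner_matrix_diff:
  assumes "sym_pos_def A"
  shows "(x - y) \<bullet> (A *v (x - y)) = x \<bullet> (A *v x) - 2 * (y \<bullet> (A *v x)) + y \<bullet> (A *v y)"
  using sym_pos_defD(1)[OF assms, of x y]
  by (simp add: matrix_vector_mult_diff_distrib inner_diff_left inner_diff_right inner_commute)

text \<open>Completing the square at the sample mean: as a function of the unknown mean, the
  likelihood is a constant times a Gaussian density with covariance \<Sigma> / n.\<close>

lemma likelihood_mean_add:
  assumes \<Sigma>: "sym_pos_def \<Sigma>" and n: "n \<ge> 1" and xbar: "xbar = (1 / real n) *\<^sub>R (\<Sum>i=1..n. x i)"
  shows "likelihood \<Sigma> n x (xbar + u)
    = likelihood \<Sigma> n x xbar * exp (- (real n * (u \<bullet> (matrix_inv \<Sigma> *v u))) / 2)"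
proof -
  let ?c = "(2 * pi) powr (- real CARD('a) / 2) * det \<Sigma> powr (- 1 / 2)"
  let ?q = "\<lambda>v. v \<bullet> (matrix_inv \<Sigma> *v v)"
  have L: "likelihood \<Sigma> n x \<theta> = ?c ^ n * exp (- (\<Sum>i=1..n. ?q (x i - \<theta>)) / 2)" for \<theta>
    by (simp add: likelihood_def mvn_density_def prod.distrib exp_sum[symmetric] sum_distrib_left
        sum_negf[symmetric] sum_divide_distrib)
  \<comment> \<open>The deviations from the sample mean sum to zero, which removes the term linear
    in \<open>u\<close>.\<close>
  have "(\<Sum>i=1..n. x i - xbar) = 0"
    using n by (simp add: sum_subtractf xbar sum_constant_scaleR del: sum_constant)
  then have "(\<Sum>i=1..n. u \<bullet> (matrix_inv \<Sigma> *v (x i - xbar))) = 0"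
    by (metis inner_sum_right inner_zero_right linear_sum[OF matrix_vector_mul_linear]
        matrix_vector_mult_0_right)
  moreover have "?q (x i - (xbar + u))
      = ?q (x i - xbar) - 2 * (u \<bullet> (matrix_inv \<Sigma> *v (x i - xbar))) + ?q u" for i
    using inner_matrix_diff[OF sym_pos_def_matrix_inv[OF \<Sigma>], of "x i - xbar" u]
    by (simp add: diff_diff_add)
  ultimately have "(\<Sum>i=1..n. ?q (x i - (xbar + u))) = (\<Sum>i=1..n. ?q (x i - xbar)) + real n * ?q u"
    by (simp add: sum.distrib sum_subtractf sum_distrib_left[symmetric])
  then show ?thesis
    by (simp add: L exp_add[symmetric] add_divide_distrib)
qed

subsection \<open>Linear images of Lebesgue measure\<close>

text \<open>The Jacobian is a power of \<open>\<bar>c\<bar> = 1\<close>. The reflection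
  \<open>c = -1\<close> is included because the next lemma has to integrate
  \<open>g (x - L y)\<close> over \<open>y\<close>.\<close>

lemma nn_integral_lborel_affine:
  fixes F :: "'a::euclidean_space \<Rightarrow> ennreal"
  assumes [measurable]: "F \<in> borel_measurable borel" and c: "\<bar>c\<bar> = 1"
  shows "(\<integral>\<^sup>+x. F (t + c *\<^sub>R x) \<partial>lborel) = (\<integral>\<^sup>+x. F x \<partial>lborel)"
proof -
  have "c \<noteq> 0" using c by auto
  then have "lborel = distr lborel borel (\<lambda>x. t + c *\<^sub>R x)"
    using lborel_affine[of c t] c by (simp add: density_1)
  then have "(\<integral>\<^sup>+x. F x \<partial>lborel) = (\<integral>\<^sup>+x. F x \<partial>distr lborel borel (\<lambda>x. t + c *\<^sub>R x))"
    by simp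
  also have "\<dots> = (\<integral>\<^sup>+x. F (t + c *\<^sub>R x) \<partial>lborel)"
    by (simp add: nn_integral_distr)
  finally show ?thesis by simp
qed

text \<open>The usual proof that a translation invariant measure is unique up to a factor, applied to
  the image of Lebesgue measure under \<open>L\<close>: both sides arise from integrating
  \<open>g x * f (x + L y)\<close>. The determinant formula of the library is not used, because it requires a
  well-ordered index type.\<close>

lemma nn_integral_linear_ratio:
  fixes L :: "'a::euclidean_space \<Rightarrow> 'a" and f g :: "'a \<Rightarrow> ennreal"
  assumes lin: "linear L" and bij: "bij L"
    and [measurable]: "f \<in> borel_measurable borel" "g \<in> borel_measurable borel"
  shows "(\<integral>\<^sup>+x. g x \<partial>lborel) * (\<integral>\<^sup>+y. f (L y) \<partial>lborel)
       = (\<integral>\<^sup>+x. f x \<partial>lborel) * (\<integral>\<^sup>+y. g (L y) \<partial>lborel)"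
proof -
  have [measurable]: "L \<in> borel_measurable borel"
    using lin by (intro borel_measurable_continuous_onI linear_continuous_on)
      (simp add: linear_conv_bounded_linear)
  have LK: "L (inv L x) = x" for x using bij by (simp add: bij_is_surj surj_f_inv_f)
  \<comment> \<open>Since \<open>L\<close> is onto, translating the argument of \<open>h\<close> by
    \<open>x\<close> amounts to translating \<open>y\<close> by \<open>inv L x\<close>.\<close>
  have shift: "(\<integral>\<^sup>+y. h (x + c *\<^sub>R L y) \<partial>lborel) = (\<integral>\<^sup>+y. h (L y) \<partial>lborel)"
    if [measurable]: "h \<in> borel_measurable borel" and c: "\<bar>c\<bar> = 1" for h :: "'a \<Rightarrow> ennreal" and x c
  proof -
    have "L (inv L x + c *\<^sub>R y) = x + c *\<^sub>R L y" for y
      by (simp add: linear_add[OF lin] linear_scale[OF lin] LK)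
    then show ?thesis
      using nn_integral_lborel_affine[of "\<lambda>y. h (L y)" c "inv L x"] c by simp
  qed
  have "(\<integral>\<^sup>+x. g x \<partial>lborel) * (\<integral>\<^sup>+y. f (L y) \<partial>lborel)
      = (\<integral>\<^sup>+x. g x * (\<integral>\<^sup>+y. f (x + L y) \<partial>lborel) \<partial>lborel)"
    using shift[of f 1] by (simp add: nn_integral_multc)
  also have "\<dots> = (\<integral>\<^sup>+x. (\<integral>\<^sup>+y. g x * f (x + L y) \<partial>lborel) \<partial>lborel)"
    by (simp add: nn_integral_cmult)
  also have "\<dots> = (\<integral>\<^sup>+y. (\<integral>\<^sup>+x. g x * f (x + L y) \<partial>lborel) \<partial>lborel)"
    by (rule lborel_pair.Fubini') measurable
  also have "\<dots> = (\<integral>\<^sup>+y. (\<integral>\<^sup>+x. g (x - L y) * f x \<partial>lborel) \<partial>lborel)"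
  proof (rule nn_integral_cong)
    fix y
    show "(\<integral>\<^sup>+x. g x * f (x + L y) \<partial>lborel) = (\<integral>\<^sup>+x. g (x - L y) * f x \<partial>lborel)"
      using nn_integral_lborel_affine[of "\<lambda>x. g (x - L y) * f x" 1 "L y"] by (simp add: add.commute)
  qed
  also have "\<dots> = (\<integral>\<^sup>+x. (\<integral>\<^sup>+y. g (x - L y) * f x \<partial>lborel) \<partial>lborel)"
    by (rule lborel_pair.Fubini') measurable
  also have "\<dots> = (\<integral>\<^sup>+x. (\<integral>\<^sup>+y. g (x - L y) \<partial>lborel) * f x \<partial>lborel)"
    by (simp add: nn_integral_multc)
  also have "\<dots> = (\<integral>\<^sup>+x. f x \<partial>lborel) * (\<integral>\<^sup>+y. g (L y) \<partial>lborel)"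
    using shift[of g "-1"] by (simp add: nn_integral_multc mult.commute)
  finally show ?thesis .
qed

text \<open>The ratio identity is applied to the indicator of the unit ball, so \<open>c\<close> is
  the volume of the ball over that of its preimage. The offset \<open>m\<close> is absorbed by
  translation invariance.\<close>

lemma nn_integral_linear_image:
  fixes L :: "'a::euclidean_space \<Rightarrow> 'a"
  assumes lin: "linear L" and bij: "bij L"
  obtains c where "0 < c" "c < \<infinity>"
    "\<And>(f :: 'a \<Rightarrow> ennreal) m. f \<in> borel_measurable borel \<Longrightarrow>
      (\<integral>\<^sup>+x. f x \<partial>lborel) = c * (\<integral>\<^sup>+y. f (m + L y) \<partial>lborel)"
proof -
  have cont: "continuous_on UNIV L"
    using lin by (intro linear_continuous_on) (simp add: linear_conv_bounded_linear)
  have [measurable]: "L \<in> borel_measurable borel"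
    using cont by (rule borel_measurable_continuous_onI)
  define a where "a = emeasure lborel (ball (0::'a) 1)"
  define b where "b = emeasure lborel (L -` ball 0 1)"
  have op: "open (L -` ball 0 1)" using cont by (simp add: open_vimage)
  have a: "0 < a" "a < \<infinity>"
    by (simp_all add: a_def emeasure_ball emeasure_lborel_ball_finite)
  \<comment> \<open>The preimage is bounded, so \<open>b\<close> is finite; it is open and contains
    0, so \<open>b\<close> is nonzero.\<close>
  have "L -` ball 0 1 = inv L ` ball 0 1" by (simp add: bij bij_vimage_eq_inv_image)
  also have "bounded \<dots>"
    using inj_linear_imp_inv_linear[OF lin bij_is_inj[OF bij]]
    by (intro bounded_linear_image) (auto simp: linear_conv_bounded_linear)
  finally have "b < \<infinity>" unfolding b_def by (rule emeasure_bounded_finite)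
  have "b \<noteq> 0"
  proof
    assume "b = 0"
    then have "negligible (L -` ball 0 1)"
      using op by (simp add: b_def negligible_iff_null_sets null_sets_completionI null_sets_def)
    moreover have "0 \<in> L -` ball 0 1" by (simp add: linear_0[OF lin])
    ultimately show False using op open_not_negligible by blast
  qed
  show thesis
  proof (rule that[of "a / b"])
    show "0 < a / b" "a / b < \<infinity>"
      using a \<open>b < \<infinity>\<close> \<open>b \<noteq> 0\<close> by (auto simp: ennreal_divide_eq_top_iff less_top[symmetric] zero_less_iff_neq_zero ennreal_divide_eq_0_iff)
    fix f :: "'a \<Rightarrow> ennreal" and m assume [measurable]: "f \<in> borel_measurable borel"
    have "(indicator (ball 0 1) :: 'a \<Rightarrow> ennreal) \<in> borel_measurable borel"
      by (intro borel_measurable_indicator) simp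
    then have "a * (\<integral>\<^sup>+y. f (m + L y) \<partial>lborel) = (\<integral>\<^sup>+x. f (m + x) \<partial>lborel) * b"
      using nn_integral_linear_ratio[OF lin bij, of "\<lambda>x. f (m + x)" "indicator (ball 0 1)"] op
      by (simp add: a_def b_def indicator_vimage[symmetric] nn_integral_indicator)
    also have "(\<integral>\<^sup>+x. f (m + x) \<partial>lborel) = (\<integral>\<^sup>+x. f x \<partial>lborel)"
      using nn_integral_lborel_affine[of f 1 m] by simp
    finally have "a * (\<integral>\<^sup>+y. f (m + L y) \<partial>lborel) / b = (\<integral>\<^sup>+x. f x \<partial>lborel)"
      using \<open>b < \<infinity>\<close> \<open>b \<noteq> 0\<close> by (simp add: ennreal_mult_divide_eq)
    then show "(\<integral>\<^sup>+x. f x \<partial>lborel) = a / b * (\<integral>\<^sup>+y. f (m + L y) \<partial>lborel)"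
      by (simp add: ennreal_times_divide ennreal_divide_times mult.commute)
  qed
qed

subsection \<open>Gaussian measures\<close>

text \<open>In the variable \<open>\<bar>x\<bar>\<^sup>2 / 2\<close> the Gaussian moments become Gamma integrals directly.\<close>

lemma distr_half_norm_square:
  defines "n \<equiv> real DIM('a::euclidean_space)"
  shows "distr lborel borel (\<lambda>x::'a. (norm x)\<^sup>2 / 2)
    = density lborel (\<lambda>t. ennreal (unit_ball_vol n * 2 powr (n / 2) * (n / 2))
        * ennreal (indicator {0..} t * t powr (n / 2 - 1)))" (is "?M = density lborel ?k")
proof (rule measure_eqI_generator_eq)
  let ?E = "range (\<lambda>a::real. {..a})"
  have n: "n > 0" by (simp add: n_def)
  \<comment> \<open>Half-lines suffice. The preimage of \<open>{..a}\<close> is a ball of radius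
    \<open>sqrt (2 * a)\<close>, whose volume is
    \<open>unit_ball_vol n * (2 * a) powr (n / 2)\<close>; the density \<open>?k\<close> is its
    derivative in \<open>a\<close>.\<close>
  have *: "emeasure ?M {..a} = emeasure (density lborel ?k) {..a}
    \<and> emeasure ?M {..a} \<noteq> \<infinity>" for a
  proof (cases "a \<ge> 0")
    case True
    have "(norm x)\<^sup>2 / 2 \<le> a \<longleftrightarrow> norm x \<le> sqrt (2 * a)" for x :: 'a
      using real_sqrt_le_iff[of "(norm x)\<^sup>2" "2 * a"] by (simp add: field_simps)
    then have "(\<lambda>x::'a. (norm x)\<^sup>2 / 2) -` {..a} = cball 0 (sqrt (2 * a))" by auto
    then have "emeasure ?M {..a} = ennreal (unit_ball_vol n * sqrt (2 * a) ^ DIM('a))"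
      using True by (simp add: emeasure_distr emeasure_cball n_def)
    also have "sqrt (2 * a) ^ DIM('a) = (2 * a) powr (n / 2)"
      using True by (cases "a = 0")
        (simp_all add: n_def powr_half_sqrt[symmetric] powr_realpow[symmetric] powr_powr)
    also have "\<dots> = 2 powr (n / 2) * a powr (n / 2)" using True by (simp add: powr_mult)
    finally have 1: "emeasure ?M {..a} = ennreal (unit_ball_vol n * (2 powr (n / 2) * a powr (n / 2)))" .
    have "((\<lambda>t. t powr (n / 2 - 1)) has_integral a powr (n / 2) / (n / 2)) {0..a}"
      using has_integral_powr_from_0[of "n / 2 - 1" a] n True by simp
    from nn_integral_has_integral_lebesgue'[OF _ this]
    have I: "(\<integral>\<^sup>+t. ennreal (t powr (n / 2 - 1)) * indicator {0..a} t \<partial>lborel)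
        = ennreal (a powr (n / 2) / (n / 2))" by simp
    have "emeasure (density lborel ?k) {..a} = (\<integral>\<^sup>+t. ?k t * indicator {..a} t \<partial>lborel)"
      by (simp add: emeasure_density)
    also have "\<dots> = (\<integral>\<^sup>+t. ennreal (unit_ball_vol n * 2 powr (n / 2) * (n / 2))
        * (ennreal (t powr (n / 2 - 1)) * indicator {0..a} t) \<partial>lborel)"
      by (intro nn_integral_cong) (auto simp: indicator_def)
    also have "\<dots> = ennreal (unit_ball_vol n * 2 powr (n / 2) * (n / 2))
        * ennreal (a powr (n / 2) / (n / 2))"
      by (simp add: nn_integral_cmult I)
    also have "\<dots> = emeasure ?M {..a}"
      unfolding 1 using n by (simp add: ennreal_mult[symmetric])
    finally show ?thesis using 1 by simp
  next
    case False
    have "(\<lambda>x::'a. (norm x)\<^sup>2 / 2) -` {..a} = {}"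
      using False by (auto simp: not_le) (smt (verit) zero_le_power2)
    moreover have "(\<lambda>t. ?k t * indicator {..a} t) = (\<lambda>t. 0)"
      using False by (intro ext) (auto simp: indicator_def)
    then have "emeasure (density lborel ?k) {..a} = (\<integral>\<^sup>+(t::real). 0 \<partial>lborel)"
      by (subst emeasure_density) auto
    ultimately show ?thesis by (simp add: emeasure_distr)
  qed
  show "Int_stable ?E" by (auto simp: Int_stable_def)
  show "?E \<subseteq> Pow UNIV" by simp
  show "emeasure ?M X = emeasure (density lborel ?k) X" if "X \<in> ?E" for X using that * by auto
  show "sets ?M = sigma_sets UNIV ?E" "sets (density lborel ?k) = sigma_sets UNIV ?E"
    by (simp_all add: borel_eq_atMost)
  show "range (\<lambda>i. {..real i}) \<subseteq> ?E" by auto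
  show "(\<Union>i. {..real i}) = UNIV" by (auto intro: real_arch_simple)
  show "emeasure ?M {..real i} \<noteq> \<infinity>" for i using * by blast
qed

text \<open>With \<open>t = (norm x)^2 / 2\<close> the two integrals are
  \<open>C * Gamma (n / 2)\<close> and \<open>C * sqrt 2 * Gamma (n / 2 + 1 / 2)\<close>, the factor
  \<open>norm x = sqrt (2 * t)\<close> raising the Gamma argument by one half. The common
  \<open>C\<close> cancels.\<close>

lemma nn_integral_norm_gaussian:
  defines "n \<equiv> real DIM('a::euclidean_space)"
  shows "0 < (\<integral>\<^sup>+(x::'a). ennreal (exp (- (norm x)\<^sup>2 / 2)) \<partial>lborel)" (is "0 < ?Z")
    and "(\<integral>\<^sup>+(x::'a). ennreal (exp (- (norm x)\<^sup>2 / 2)) \<partial>lborel) < \<infinity>"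
    and "(\<integral>\<^sup>+(x::'a). ennreal (norm x * exp (- (norm x)\<^sup>2 / 2)) \<partial>lborel)
      = ennreal (sqrt 2 * Gamma (n / 2 + 1 / 2) / Gamma (n / 2))
        * (\<integral>\<^sup>+(x::'a). ennreal (exp (- (norm x)\<^sup>2 / 2)) \<partial>lborel)"
proof -
  have n: "n > 0" by (simp add: n_def)
  define C where "C = unit_ball_vol n * 2 powr (n / 2) * (n / 2)"
  have C: "C > 0" using n by (simp add: C_def)
  have radial: "(\<integral>\<^sup>+(x::'a). ennreal (F ((norm x)\<^sup>2 / 2)) \<partial>lborel)
      = ennreal C * (\<integral>\<^sup>+t. ennreal (indicator {0..} t * t powr (n / 2 - 1)) * ennreal (F t) \<partial>lborel)"
    if [measurable]: "F \<in> borel_measurable borel" for F :: "real \<Rightarrow> real"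
  proof -
    have "(\<integral>\<^sup>+(x::'a). ennreal (F ((norm x)\<^sup>2 / 2)) \<partial>lborel)
      = (\<integral>\<^sup>+t. ennreal (F t) \<partial>distr lborel borel (\<lambda>x::'a. (norm x)\<^sup>2 / 2))"
      by (simp add: nn_integral_distr)
    also have "\<dots> = (\<integral>\<^sup>+t. ennreal C * (ennreal (indicator {0..} t * t powr (n / 2 - 1)) * ennreal (F t)) \<partial>lborel)"
      unfolding distr_half_norm_square C_def n_def
      by (simp add: nn_integral_density mult.assoc)
    finally show ?thesis by (simp add: nn_integral_cmult)
  qed
  have "ennreal (indicator {0..} t * t powr (n / 2 - 1)) * ennreal (exp (- t))
      = ennreal (indicator {0..} t * t powr (n / 2 - 1) / exp t)" for t :: real
    unfolding exp_minus divide_inverse by (rule ennreal_mult''[symmetric]) simp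
  then have "?Z = ennreal C * (\<integral>\<^sup>+t. ennreal (indicator {0..} t * t powr (n / 2 - 1) / exp t) \<partial>lborel)"
    using radial[of "\<lambda>t. exp (- t)"] by simp
  also have "\<dots> = ennreal C * ennreal (Gamma (n / 2))"
    using n by (simp add: Gamma_conv_nn_integral_real)
  also have "\<dots> = ennreal (C * Gamma (n / 2))"
    using C by (simp add: ennreal_mult'[symmetric])
  finally have Z': "?Z = ennreal (C * Gamma (n / 2))" .
  show "0 < ?Z" "?Z < \<infinity>" unfolding Z' using C n by simp_all
  have "(\<integral>\<^sup>+(x::'a). ennreal (norm x * exp (- (norm x)\<^sup>2 / 2)) \<partial>lborel)
     = ennreal C * (\<integral>\<^sup>+t. ennreal (indicator {0..} t * t powr (n / 2 - 1))
         * ennreal (sqrt (2 * t) * exp (- t)) \<partial>lborel)"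
    using radial[of "\<lambda>t. sqrt (2 * t) * exp (- t)"] by simp
  also have "(\<integral>\<^sup>+t. ennreal (indicator {0..} t * t powr (n / 2 - 1))
         * ennreal (sqrt (2 * t) * exp (- t)) \<partial>lborel)
     = (\<integral>\<^sup>+t. ennreal (sqrt 2) * ennreal (indicator {0..} t * t powr (n / 2 + 1 / 2 - 1) / exp t) \<partial>lborel)"
  proof (rule nn_integral_cong)
    fix t :: real
    have *: "indicator {0..} t * t powr (n / 2 - 1) * (sqrt (2 * t) * exp (- t))
      = sqrt 2 * (indicator {0..} t * t powr (n / 2 + 1 / 2 - 1) / exp t)"
    \<comment> \<open>At \<open>t = 0\<close> both sides vanish, because \<open>0 powr a = 0\<close>
      for every \<open>a\<close>.\<close>
    proof (cases "t > 0")
      case True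
      have "t powr (n / 2 + 1 / 2 - 1) = t powr (n / 2 - 1) * sqrt t"
        using True by (simp add: powr_half_sqrt[symmetric] powr_add[symmetric])
      then show ?thesis
        using True by (simp add: real_sqrt_mult exp_minus field_simps)
    qed (auto simp: indicator_def)
    show "ennreal (indicator {0..} t * t powr (n / 2 - 1)) * ennreal (sqrt (2 * t) * exp (- t))
      = ennreal (sqrt 2) * ennreal (indicator {0..} t * t powr (n / 2 + 1 / 2 - 1) / exp t)"
    proof (cases "t \<ge> 0")
      case True
      then show ?thesis
        by (subst (1 2) ennreal_mult[symmetric]) (simp_all only: *, auto)
    qed (auto simp: indicator_def)
  qed
  also have "\<dots> = ennreal (sqrt 2) * ennreal (Gamma (n / 2 + 1 / 2))"
    using n by (simp add: nn_integral_cmult Gamma_conv_nn_integral_real)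
  also have "ennreal C * \<dots> = ennreal (sqrt 2 * Gamma (n / 2 + 1 / 2) / Gamma (n / 2)) * ?Z"
    unfolding Z' using C n Gamma_real_pos[of "n / 2"] Gamma_real_pos[of "n / 2 + 1 / 2"]
      less_imp_neq[OF Gamma_real_pos[of "n / 2"]]
    by (simp add: ennreal_mult[symmetric] less_imp_le)
  finally show "(\<integral>\<^sup>+(x::'a). ennreal (norm x * exp (- (norm x)\<^sup>2 / 2)) \<partial>lborel)
      = ennreal (sqrt 2 * Gamma (n / 2 + 1 / 2) / Gamma (n / 2)) * ?Z" .
qed

section \<open>Posteriors as affine images of a standard Gaussian vector\<close>

lemma ennreal_divide_cancel_left:
  fixes a x y :: ennreal
  assumes "0 < a" "a < \<infinity>"
  shows "(a * x) / (a * y) = x / y"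
proof -
  have "inverse (a * y) = inverse a * inverse y"
    using assms by (intro ennreal_inverse_mult') (auto simp: less_top)
  then have "(a * x) / (a * y) = (a * inverse a) * (x * inverse y)"
    by (simp only: divide_ennreal_def mult_ac)
  also have "a * inverse a = 1"
    using assms by (simp only: divide_ennreal_def[symmetric]) (intro ennreal_divide_self, auto)
  finally show ?thesis by (simp add: divide_ennreal_def)
qed

text \<open>Moves a prior density into the likelihood, so that the posterior under the Gaussian
  prior becomes one over \<open>lborel\<close> and \<open>posterior_affine\<close> applies to both
  posteriors.\<close>

lemma posterior_density:
  assumes [measurable]: "p \<in> borel_measurable M" "L \<in> borel_measurable M"
    and p: "\<And>x. 0 \<le> p x"
  shows "posterior (density M (\<lambda>x. ennreal (p x))) L = posterior M (\<lambda>x. p x * L x)"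
  by (simp add: posterior_def density_density_eq nn_integral_density ennreal_mult'[OF p]
      ennreal_times_divide)

text \<open>The Jacobian \<open>c\<close> and the constant \<open>K\<close> enter both the density
  and its normalising integral and cancel. Hence no determinant and no normalising constant has to
  be evaluated.\<close>

lemma posterior_affine:
  fixes T :: "'a::euclidean_space \<Rightarrow> 'a"
  assumes lin: "linear T" and bij: "bij T" and K: "0 < K"
    and [measurable]: "q \<in> borel_measurable borel" "g \<in> borel_measurable borel"
    and q: "\<And>z. q (m + T z) = K * g z"
  shows "posterior lborel q = distr (posterior lborel g) borel (\<lambda>z. m + T z)"
proof -
  have [measurable]: "T \<in> borel_measurable borel"
    using lin by (intro borel_measurable_continuous_onI linear_continuous_on)
      (simp add: linear_conv_bounded_linear)
  obtain c where c: "0 < c" "c < \<infinity>"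
    and int: "\<And>f. f \<in> borel_measurable borel \<Longrightarrow>
      (\<integral>\<^sup>+x. f x \<partial>lborel) = c * (\<integral>\<^sup>+y. f (m + T y) \<partial>lborel)"
    using nn_integral_linear_image[OF lin bij] by metis
  define Z where "Z = (\<integral>\<^sup>+z. ennreal (g z) \<partial>lborel)"
  define Y where "Y = (\<integral>\<^sup>+z. ennreal (q z) \<partial>lborel)"
  define a where "a = c * ennreal K"
  have a: "0 < a" "a < \<infinity>"
    using c K by (simp_all add: a_def ennreal_zero_less_mult_iff ennreal_mult_less_top)
  have Kg: "ennreal (K * g z) = ennreal K * ennreal (g z)" for z
    using K by (simp add: ennreal_mult')
  have Y: "Y = a * Z"
    using int[of "\<lambda>z. ennreal (q z)"]
    by (simp add: q Kg nn_integral_cmult a_def Y_def Z_def mult.assoc)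
  show ?thesis
  proof (rule measure_eqI)
    show "sets (posterior lborel q) = sets (distr (posterior lborel g) borel (\<lambda>z. m + T z))"
      by (simp add: posterior_def)
    fix X assume "X \<in> sets (posterior lborel q)"
    then have [measurable]: "X \<in> sets borel" by (simp add: posterior_def)
    have pre[measurable]: "(\<lambda>z. m + T z) -` X \<in> sets borel"
      using measurable_sets[of "\<lambda>z. m + T z" borel borel X] by simp
    have "emeasure (posterior lborel q) X = (\<integral>\<^sup>+x. ennreal (q x) / Y * indicator X x \<partial>lborel)"
      by (simp add: posterior_def emeasure_density Y_def)
    also have "\<dots> = c * (\<integral>\<^sup>+z. ennreal (q (m + T z)) / Y * indicator X (m + T z) \<partial>lborel)"
      by (rule int) measurable
    also have "\<dots> = (\<integral>\<^sup>+z. c * (ennreal (q (m + T z)) / Y * indicator X (m + T z)) \<partial>lborel)"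
      by (rule nn_integral_cmult[symmetric]) measurable
    also have "\<dots> = (\<integral>\<^sup>+z. ennreal (g z) / Z * indicator ((\<lambda>z. m + T z) -` X) z \<partial>lborel)"
    proof (rule nn_integral_cong)
      fix z
      have "c * (ennreal (q (m + T z)) / Y) = a * ennreal (g z) / (a * Z)"
        by (simp add: q Kg Y a_def ennreal_times_divide mult.assoc)
      then have "c * (ennreal (q (m + T z)) / Y) = ennreal (g z) / Z"
        using ennreal_divide_cancel_left[OF a] by simp
      then show "c * (ennreal (q (m + T z)) / Y * indicator X (m + T z))
          = ennreal (g z) / Z * indicator ((\<lambda>z. m + T z) -` X) z"
        by (simp add: mult.assoc[symmetric] indicator_def)
    qed
    also have "\<dots> = emeasure (distr (posterior lborel g) borel (\<lambda>z. m + T z)) X"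
      by (simp add: posterior_def emeasure_distr emeasure_density Z_def)
    finally show "emeasure (posterior lborel q) X
      = emeasure (distr (posterior lborel g) borel (\<lambda>z. m + T z)) X" .
  qed
qed

text \<open>The law N(0, I), normalised through \<open>posterior\<close> so that it matches the
  right-hand side of \<open>posterior_affine\<close> directly.\<close>

definition std_gaussian :: "'a::euclidean_space measure" where
  "std_gaussian = posterior lborel (\<lambda>z. exp (- (norm z)\<^sup>2 / 2))"

lemma sets_std_gaussian [simp, measurable_cong]: "sets std_gaussian = sets borel"
  by (simp add: std_gaussian_def posterior_def)

lemma space_std_gaussian [simp]: "space std_gaussian = UNIV"
  by (simp add: std_gaussian_def posterior_def)

lemma emeasure_std_gaussian_UNIV: "emeasure (std_gaussian :: 'a::euclidean_space measure) UNIV = 1"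
proof -
  let ?Z = "\<integral>\<^sup>+(z::'a). ennreal (exp (- (norm z)\<^sup>2 / 2)) \<partial>lborel"
  have "emeasure (std_gaussian :: 'a measure) UNIV = ?Z / ?Z"
    by (simp add: std_gaussian_def posterior_def emeasure_density nn_integral_divide)
  also have "\<dots> = 1"
    using nn_integral_norm_gaussian(1,2)[where 'a='a] by (intro ennreal_divide_self) auto
  finally show ?thesis .
qed

text \<open>This is the mean of the chi distribution with \<open>DIM('a)\<close> degrees of freedom,
  the Gamma quotient of the final bound.\<close>

lemma nn_integral_norm_std_gaussian:
  "(\<integral>\<^sup>+(z::'a). ennreal (norm z) \<partial>(std_gaussian :: 'a::euclidean_space measure))
    = ennreal (sqrt 2 * Gamma (real DIM('a) / 2 + 1 / 2) / Gamma (real DIM('a) / 2))"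
proof -
  let ?Z = "\<integral>\<^sup>+(z::'a). ennreal (exp (- (norm z)\<^sup>2 / 2)) \<partial>lborel"
  have "(\<integral>\<^sup>+(z::'a). ennreal (norm z) \<partial>std_gaussian)
      = (\<integral>\<^sup>+(z::'a). ennreal (norm z * exp (- (norm z)\<^sup>2 / 2)) / ?Z \<partial>lborel)"
    by (simp add: std_gaussian_def posterior_def nn_integral_density ennreal_mult'
        ennreal_times_divide mult.commute)
  also have "\<dots> = (\<integral>\<^sup>+(z::'a). ennreal (norm z * exp (- (norm z)\<^sup>2 / 2)) \<partial>lborel) / ?Z"
    by (rule nn_integral_divide) measurable
  also have "\<dots> = ennreal (sqrt 2 * Gamma (real DIM('a) / 2 + 1 / 2) / Gamma (real DIM('a) / 2))"
    using nn_integral_norm_gaussian[where 'a='a] by (simp add: ennreal_mult_divide_eq)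
  finally show ?thesis .
qed

text \<open>Both measures are images of the same Gaussian vector, so this is the bound given by the
  synchronous coupling.\<close>

lemma wasserstein1_affine_std_gaussian:
  fixes S T :: "'a::euclidean_space \<Rightarrow> 'a"
  assumes S: "linear S" and T: "linear T"
  shows "wasserstein1 (distr std_gaussian borel (\<lambda>z. a + S z)) (distr std_gaussian borel (\<lambda>z. b + T z))
    \<le> ereal (norm (a - b) + onorm (\<lambda>z. S z - T z)
        * (sqrt 2 * Gamma (real DIM('a) / 2 + 1 / 2) / Gamma (real DIM('a) / 2)))"
proof -
  let ?G = "std_gaussian :: 'a measure"
  define \<kappa> where "\<kappa> = sqrt 2 * Gamma (real DIM('a) / 2 + 1 / 2) / Gamma (real DIM('a) / 2)"
  have \<kappa>: "\<kappa> \<ge> 0" by (auto simp: \<kappa>_def intro!: divide_nonneg_nonneg mult_nonneg_nonneg Gamma_real_nonneg)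
  have int_norm: "integrable ?G norm" "(\<integral>z. norm z \<partial>?G) = \<kappa>"
    using nn_integral_norm_std_gaussian[where 'a='a] \<kappa>
    by (auto simp: \<kappa>_def[symmetric] integral_eq_nn_integral intro!: integrableI_bounded)
  interpret finite_measure ?G
    by (rule finite_measureI) (simp add: emeasure_std_gaussian_UNIV)
  have G1: "measure ?G UNIV = 1" by (simp add: measure_def emeasure_std_gaussian_UNIV)
  have meas: "V \<in> borel_measurable borel" if "linear V" for V :: "'a \<Rightarrow> 'a"
    using that by (intro borel_measurable_continuous_onI linear_continuous_on)
      (simp add: linear_conv_bounded_linear)
  \<comment> \<open>A Lipschitz \<open>h\<close> grows at most linearly and \<open>norm\<close> is
    integrable. Integrability is what permits merging the two integrals into one.\<close>
  have int: "integrable ?G (\<lambda>z. h (c + V z))" if h: "1-lipschitz_on UNIV h" and V: "linear V"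
    for h :: "'a \<Rightarrow> real" and V c
  proof (rule Bochner_Integration.integrable_bound)
    show "integrable ?G (\<lambda>z. \<bar>h c\<bar> + onorm V * norm z)"
      using int_norm(1) by simp
    have [measurable]: "V \<in> borel_measurable borel" "h \<in> borel_measurable borel"
      using V h by (auto intro: meas borel_measurable_continuous_onI lipschitz_on_continuous_on)
    show "(\<lambda>z. h (c + V z)) \<in> borel_measurable ?G" by measurable
    have "norm (h (c + V z)) \<le> norm (\<bar>h c\<bar> + onorm V * norm z)" for z
    proof -
      have "\<bar>h (c + V z) - h c\<bar> \<le> norm (V z)"
        using lipschitz_onD[OF h, of "c + V z" c] by (simp add: dist_norm)
      also have "\<dots> \<le> onorm V * norm z"
        using V by (intro onorm) (simp add: linear_conv_bounded_linear)
      finally show ?thesis by simp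
    qed
    then show "AE z in ?G. norm (h (c + V z)) \<le> norm (\<bar>h c\<bar> + onorm V * norm z)" by simp
  qed
  have "\<bar>(\<integral>x. h x \<partial>distr ?G borel (\<lambda>z. a + S z)) - (\<integral>x. h x \<partial>distr ?G borel (\<lambda>z. b + T z))\<bar>
      \<le> norm (a - b) + onorm (\<lambda>z. S z - T z) * \<kappa>" if h: "1-lipschitz_on UNIV h" for h
  proof -
    have [measurable]: "S \<in> borel_measurable borel" "T \<in> borel_measurable borel" "h \<in> borel_measurable borel"
      using S T h by (auto intro: meas borel_measurable_continuous_onI lipschitz_on_continuous_on)
    have bl: "bounded_linear (\<lambda>z. S z - T z)"
      using S T by (intro bounded_linear_sub) (simp_all add: linear_conv_bounded_linear)
    have "\<bar>(\<integral>x. h x \<partial>distr ?G borel (\<lambda>z. a + S z)) - (\<integral>x. h x \<partial>distr ?G borel (\<lambda>z. b + T z))\<bar>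
      = \<bar>\<integral>z. h (a + S z) - h (b + T z) \<partial>?G\<bar>"
      using int[OF h S] int[OF h T] by (simp add: integral_distr)
    also have "\<dots> \<le> (\<integral>z. norm (a - b) + onorm (\<lambda>z. S z - T z) * norm z \<partial>?G)"
    proof (rule order_trans[OF integral_abs_bound integral_mono])
      show "integrable ?G (\<lambda>z. \<bar>h (a + S z) - h (b + T z)\<bar>)"
        using int[OF h S] int[OF h T] by simp
      show "integrable ?G (\<lambda>z. norm (a - b) + onorm (\<lambda>z. S z - T z) * norm z)"
        using int_norm(1) by simp
      fix z
      have "\<bar>h (a + S z) - h (b + T z)\<bar> \<le> norm ((a - b) + (S z - T z))"
        using lipschitz_onD[OF h, of "a + S z" "b + T z"]
        by (simp add: dist_norm algebra_simps)
      also have "\<dots> \<le> norm (a - b) + norm (S z - T z)" by (rule norm_triangle_ineq)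
      also have "norm (S z - T z) \<le> onorm (\<lambda>z. S z - T z) * norm z" by (rule onorm[OF bl])
      finally show "\<bar>h (a + S z) - h (b + T z)\<bar> \<le> norm (a - b) + onorm (\<lambda>z. S z - T z) * norm z"
        by simp
    qed
    also have "\<dots> = norm (a - b) + onorm (\<lambda>z. S z - T z) * \<kappa>"
      using int_norm G1 by simp
    finally show ?thesis .
  qed
  then show ?thesis unfolding wasserstein1_def \<kappa>_def by (auto intro!: SUP_least)
qed

section \<open>Wasserstein distance between the two posteriors\<close>

theorem corollary4p5:
  fixes \<Sigma> \<Sigma>\<^sub>2 :: "real^'d^'d" and \<mu> :: "real^'d"
    and n :: nat and x :: "nat \<Rightarrow> real^'d"
    and P\<^sub>1 P\<^sub>2 :: "(real^'d) measure" and xbar :: "real^'d"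
  assumes "sym_pos_def \<Sigma>" and "sym_pos_def \<Sigma>\<^sub>2" and "n \<ge> 1"
    and "P\<^sub>1 = posterior lborel (likelihood \<Sigma> n x)"
    and "P\<^sub>2 = posterior (mvn \<mu> \<Sigma>\<^sub>2) (likelihood \<Sigma> n x)"
    and "xbar = (1 / real n) *\<^sub>R (\<Sum>i=1..n. x i)"
  shows "wasserstein1 P\<^sub>1 P\<^sub>2 \<le> ereal
    (opnorm \<Sigma> * opnorm (matrix_inv (\<Sigma> + real n *\<^sub>R \<Sigma>\<^sub>2)) * norm (xbar - \<mu>)
     + sqrt 2 * Gamma (real CARD('d) / 2 + 1 / 2) / Gamma (real CARD('d) / 2)
       * (opnorm \<Sigma> / real n)
       * opnorm (matrix_inv (pd_sqrt
           (\<Sigma>\<^sub>2 + real n *\<^sub>R (\<Sigma>\<^sub>2 ** matrix_inv \<Sigma> ** \<Sigma>\<^sub>2)))))"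
proof -
  note \<Sigma> = assms(1) and \<Sigma>\<^sub>2 = assms(2)
  have n: "real n > 0" using assms(3) by simp
  \<comment> \<open>The posterior covariance under the uniform prior. With it the matrix under the
    root in the claim takes the form \<open>P + P A^-1 P\<close> required by the coupling.\<close>
  define A where "A = (1 / real n) *\<^sub>R \<Sigma>"
  have A: "sym_pos_def A" using \<Sigma> n by (simp add: A_def sym_pos_def_scaleR)
  have inv\<Sigma>: "\<Sigma> *v (matrix_inv \<Sigma> *v v) = v" "matrix_inv \<Sigma> *v (\<Sigma> *v v) = v" for v
    by (simp_all add: matrix_inv_vector sym_pos_def_invertible \<Sigma>)
  have "A *v (real n *\<^sub>R matrix_inv \<Sigma> *v v) = v" for v
    using n by (simp add: A_def scaleR_matrix_vector_assoc[symmetric] matrix_vector_mult_scaleR inv\<Sigma>)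
  then have A': "matrix_inv A = real n *\<^sub>R matrix_inv \<Sigma>"
    using matrix_inv_vector(2)[OF sym_pos_def_invertible[OF A]] by (metis matrix_eq)
  define R where "R = matrix_inv (pd_sqrt (\<Sigma>\<^sub>2 + real n *\<^sub>R (\<Sigma>\<^sub>2 ** matrix_inv \<Sigma> ** \<Sigma>\<^sub>2)))"
  have R: "R = matrix_inv (pd_sqrt (\<Sigma>\<^sub>2 + \<Sigma>\<^sub>2 ** matrix_inv A ** \<Sigma>\<^sub>2))"
    unfolding R_def A' by (simp only: matrix_scalar_ac scalar_matrix_assoc[symmetric])
  obtain T U :: "real^'d^'d" where invertible: "invertible T" "invertible U"
    and T: "\<And>z. (T *v z) \<bullet> (matrix_inv A *v (T *v z)) + (T *v z) \<bullet> (matrix_inv \<Sigma>\<^sub>2 *v (T *v z)) = (norm z)\<^sup>2"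
    and U: "\<And>z. (U *v z) \<bullet> (matrix_inv A *v (U *v z)) = (norm z)\<^sup>2"
    and UT: "onorm (\<lambda>z. U *v z - T *v z) \<le> opnorm A * opnorm R"
    by (rule gaussian_factor_coupling[OF A \<Sigma>\<^sub>2, folded R]) (rule that)
  have P1: "P\<^sub>1 = distr std_gaussian borel (\<lambda>z. xbar + U *v z)"
    unfolding assms(4) std_gaussian_def
  proof (rule posterior_affine)
    show "0 < likelihood \<Sigma> n x xbar"
      unfolding likelihood_def by (intro prod_pos mvn_density_pos \<Sigma>)
    show "likelihood \<Sigma> n x (xbar + U *v z) = likelihood \<Sigma> n x xbar * exp (- (norm z)\<^sup>2 / 2)" for z
      using U[of z] likelihood_mean_add[OF \<Sigma> assms(3,6), of "U *v z"]
      by (simp add: A' scaleR_matrix_vector_assoc[symmetric])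
  qed (use invertible in \<open>simp_all add: bij_matrix_vector\<close>)

  \<comment> \<open>The second posterior mean is \<open>xbar - d\<close>, at distance
    \<open>e\<close> from the prior mean. Both \<open>d\<close> and \<open>e\<close> come from
    \<open>y\<close>, so that the gradients of the two quadratic forms balance there:
    \<open>n\<close> times the inverse of \<Sigma> applied to \<open>d\<close>, and the inverse of
    \<open>\<Sigma>\<^sub>2\<close> applied to \<open>e\<close>, both equal
    \<open>n y\<close>.\<close>
  define y where "y = matrix_inv (\<Sigma> + real n *\<^sub>R \<Sigma>\<^sub>2) *v (xbar - \<mu>)"
  define d where "d = \<Sigma> *v y"
  define e where "e = real n *\<^sub>R (\<Sigma>\<^sub>2 *v y)"
  have "sym_pos_def (\<Sigma> + real n *\<^sub>R \<Sigma>\<^sub>2)"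
    using \<Sigma> \<Sigma>\<^sub>2 n by (intro sym_pos_def_add sym_pos_def_scaleR)
  then have "(\<Sigma> + real n *\<^sub>R \<Sigma>\<^sub>2) *v y = xbar - \<mu>"
    by (simp add: y_def matrix_inv_vector sym_pos_def_invertible)
  then have de: "xbar - \<mu> = d + e"
    by (simp add: d_def e_def matrix_vector_mult_add_rdistrib scaleR_matrix_vector_assoc)
  have P2: "P\<^sub>2 = distr std_gaussian borel (\<lambda>z. (xbar - d) + T *v z)"
  proof -
    let ?q\<^sub>1 = "\<lambda>v. v \<bullet> (matrix_inv \<Sigma> *v v)" and ?q\<^sub>2 = "\<lambda>v. v \<bullet> (matrix_inv \<Sigma>\<^sub>2 *v v)"
    let ?c = "(2 * pi) powr (- real CARD('d) / 2) * det \<Sigma>\<^sub>2 powr (- 1 / 2)"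
    \<comment> \<open>Collects the factors independent of \<open>z\<close>; the exponential is the
      one attained at the posterior mean, where \<open>z = 0\<close>.\<close>
    define K where "K = ?c * likelihood \<Sigma> n x xbar * exp (- (real n * ?q\<^sub>1 d + ?q\<^sub>2 e) / 2)"
    have "P\<^sub>2 = posterior lborel (\<lambda>\<theta>. mvn_density \<mu> \<Sigma>\<^sub>2 \<theta> * likelihood \<Sigma> n x \<theta>)"
      unfolding assms(5) mvn_def
      by (rule posterior_density) (simp_all add: less_imp_le mvn_density_pos \<Sigma>\<^sub>2)
    also have "\<dots> = distr std_gaussian borel (\<lambda>z. (xbar - d) + T *v z)"
      unfolding std_gaussian_def
    proof (rule posterior_affine)
      have "0 < likelihood \<Sigma> n x xbar"
        unfolding likelihood_def by (intro prod_pos mvn_density_pos \<Sigma>)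
      then show "0 < K"
        using sym_pos_def_invertible[OF \<Sigma>\<^sub>2] by (simp add: K_def invertible_det_nz)
      fix z
      define v where "v = T *v z"
      have "d \<bullet> (matrix_inv \<Sigma> *v v) = y \<bullet> v"
        by (simp add: d_def sym_pos_defD(1)[OF \<Sigma>] inv\<Sigma>)
      then have 1: "?q\<^sub>1 (v - d) = ?q\<^sub>1 v - 2 * (y \<bullet> v) + ?q\<^sub>1 d"
        using inner_matrix_diff[OF sym_pos_def_matrix_inv[OF \<Sigma>], of v d] by simp
      have "e \<bullet> (matrix_inv \<Sigma>\<^sub>2 *v v) = real n * (y \<bullet> v)"
        by (simp add: e_def sym_pos_defD(1)[OF \<Sigma>\<^sub>2] matrix_inv_vector sym_pos_def_invertible[OF \<Sigma>\<^sub>2])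
      \<comment> \<open>The difference formula is used for \<open>(v + e) - e\<close> and solved for
        the first term. Its cross term cancels the one obtained from \<open>n\<close> times the
        expansion of \<open>?q\<^sub>1 (v - d)\<close>.\<close>
      then have 2: "?q\<^sub>2 (v + e) = ?q\<^sub>2 v + 2 * real n * (y \<bullet> v) + ?q\<^sub>2 e"
        using inner_matrix_diff[OF sym_pos_def_matrix_inv[OF \<Sigma>\<^sub>2], of "v + e" e]
        by (simp add: matrix_vector_right_distrib inner_add_left inner_add_right)
      have 3: "real n * ?q\<^sub>1 v + ?q\<^sub>2 v = (norm z)\<^sup>2"
        using T[of z] by (simp add: A' v_def scaleR_matrix_vector_assoc[symmetric])
      have L: "likelihood \<Sigma> n x (xbar - d + v)
          = likelihood \<Sigma> n x xbar * exp (- (real n * ?q\<^sub>1 (v - d)) / 2)"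
        using likelihood_mean_add[OF \<Sigma> assms(3,6), of "v - d"] by (simp add: algebra_simps)
      have eq: "xbar - d + v - \<mu> = v + e" using de by (simp add: algebra_simps)
      have D: "mvn_density \<mu> \<Sigma>\<^sub>2 (xbar - d + v) = ?c * exp (- ?q\<^sub>2 (v + e) / 2)"
        unfolding mvn_density_def eq by simp
      have "- ?q\<^sub>2 (v + e) / 2 + - (real n * ?q\<^sub>1 (v - d)) / 2
          = - (real n * ?q\<^sub>1 d + ?q\<^sub>2 e) / 2 + - (norm z)\<^sup>2 / 2"
        unfolding 1 2 3[symmetric] by (simp add: field_simps)
      then have E: "exp (- ?q\<^sub>2 (v + e) / 2) * exp (- (real n * ?q\<^sub>1 (v - d)) / 2)
          = exp (- (real n * ?q\<^sub>1 d + ?q\<^sub>2 e) / 2) * exp (- (norm z)\<^sup>2 / 2)"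
        by (simp only: exp_add[symmetric])
      have "mvn_density \<mu> \<Sigma>\<^sub>2 (xbar - d + v) * likelihood \<Sigma> n x (xbar - d + v)
          = (?c * likelihood \<Sigma> n x xbar)
            * (exp (- ?q\<^sub>2 (v + e) / 2) * exp (- (real n * ?q\<^sub>1 (v - d)) / 2))"
        unfolding L D by (simp only: mult_ac)
      then show "mvn_density \<mu> \<Sigma>\<^sub>2 (xbar - d + T *v z) * likelihood \<Sigma> n x (xbar - d + T *v z)
          = K * exp (- (norm z)\<^sup>2 / 2)"
        unfolding E K_def by (simp only: v_def mult.assoc)
    qed (use invertible in \<open>simp_all add: bij_matrix_vector\<close>)
    finally show ?thesis .
  qed

  define \<kappa> where "\<kappa> = sqrt 2 * Gamma (real CARD('d) / 2 + 1 / 2) / Gamma (real CARD('d) / 2)"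
  have \<kappa>: "\<kappa> \<ge> 0"
    by (auto simp: \<kappa>_def intro!: divide_nonneg_nonneg mult_nonneg_nonneg Gamma_real_nonneg)
  have "norm d \<le> opnorm \<Sigma> * (opnorm (matrix_inv (\<Sigma> + real n *\<^sub>R \<Sigma>\<^sub>2)) * norm (xbar - \<mu>))"
    unfolding d_def y_def
    by (rule order_trans[OF opnorm_mult_le mult_left_mono[OF opnorm_mult_le opnorm_nonneg]])
  \<comment> \<open>This is where the factor \<open>1 / n\<close> of the second summand
    arises.\<close>
  moreover have "opnorm A = opnorm \<Sigma> / real n"
    using n onorm_scaleR[of "(*v) \<Sigma>" "1 / real n"]
    by (simp add: opnorm_def A_def scaleR_matrix_vector_assoc[symmetric])
  then have "onorm (\<lambda>z. U *v z - T *v z) * \<kappa> \<le> \<kappa> * (opnorm \<Sigma> / real n) * opnorm R"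
    using mult_right_mono[OF UT \<kappa>] by (simp add: mult_ac)
  moreover have "wasserstein1 P\<^sub>1 P\<^sub>2 \<le> ereal (norm d + onorm (\<lambda>z. U *v z - T *v z) * \<kappa>)"
    using wasserstein1_affine_std_gaussian[of "(*v) U" "(*v) T" xbar "xbar - d"]
    by (simp add: P1 P2 \<kappa>_def)
  ultimately show ?thesis
    unfolding \<kappa>_def[symmetric] R_def[symmetric]
    by (elim order_trans) (simp add: mult.assoc)
qed
end
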